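(* Let $\mathbb{F}$ be a finite field and let $\mathcal{C}_1\subset\mathcal{C}\subseteq\mathbb{F}^n$ be linear codes with $\dim\mathcal{C}/\mathcal{C}_1=1$, and let $\mathcal{D}=\mathcal{C}^\perp\subset\mathcal{D}_1=\mathcal{C}_1^\perp$ (so $\dim\mathcal{D}_1/\mathcal{D}=1$). Suppose there exist vectors $a_1,\ldots,a_w$ and $b_1,\ldots,b_w$ in $\mathbb{F}^n$ such that $a_i\ast b_j\in\mathcal{D}$ whenever $i+j\leq w$, and $a_i\ast b_j\in\mathcal{D}_1\setminus\mathcal{D}$ whenever $i+j=w+1$. Then $d(\mathcal{C}/\mathcal{C}_1)\geq w$.
   Context: $\perp$ is with respect to the standard inner product on $\mathbb{F}^n$; $x\ast y$ is the coordinatewise (Hadamard) product. For codes $\mathcal{C}'\subsetneq\mathcal{C}$, $d(\mathcal{C}/\mathcal{C}')=\min\{d(x,0): x\in\mathcal{C},\ x\notin\mathcal{C}'\}$, where $d$ is the Hamming distance. *)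

theory Defs
  imports "HOL-Analysis.Analysis"
begin

definition dual_code :: "('a::field ^ 'n) set \<Rightarrow> ('a ^ 'n) set"
  where "dual_code C = {y. \<forall>x\<in>C. scalar_product x y = 0}"

text \<open>
  The coordinatewise product of vectors is the library's multiplication
  \<open>(*)\<close> on \<^typ>\<open>'a ^ 'n\<close>.
\<close>

definition hamming_dist :: "'a ^ 'n \<Rightarrow> 'a ^ 'n \<Rightarrow> nat"
  where "hamming_dist x y = card {i. x $ i \<noteq> y $ i}"

text \<open>
  Meaningful only when \<open>C\<close> is not contained in \<open>C'\<close>; otherwise \<^const>\<open>Min\<close>
  is applied to the empty set.
\<close>

definition coset_distance :: "('a::zero ^ 'n) set \<Rightarrow> ('a ^ 'n) set \<Rightarrow> nat"
  where "coset_distance C C' = Min {hamming_dist x 0 | x. x \<in> C \<and> x \<notin> C'}"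

text \<open>
  Dimension of the quotient space \<open>C / C'\<close> for subspaces \<open>C' \<subseteq> C\<close>
  of the finite-dimensional space \<^typ>\<open>'a ^ 'n\<close>.
\<close>

definition quotient_dim :: "('a::field ^ 'n) set \<Rightarrow> ('a ^ 'n) set \<Rightarrow> nat"
  where "quotient_dim C C' = vec.dim C - vec.dim C'"

end

theory Submission
  imports Defs
begin

text \<open>
  For \<open>x \<in> C - C1\<close> the code \<open>C\<close> is spanned by \<open>C1\<close> and \<open>x\<close>, so an element of
  \<open>D1 - D\<close> cannot be orthogonal to \<open>x\<close>. Hence the pairings of the vectors \<open>x * a i\<close>
  with the vectors \<open>b (w + 1 - j)\<close> form a triangular matrix with nonzero diagonal. This makes
  the \<open>w\<close> vectors \<open>x * a i\<close> linearly independent, while they all live on the support of \<open>x\<close>.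
\<close>

lemma subspace_orthogonal:
  "vec.subspace {x :: 'a::field ^ 'n. scalar_product x y = 0}"
  unfolding vec.subspace_def scalar_product_def
  by (auto simp: distrib_right sum.distrib mult.assoc simp flip: sum_distrib_left)

text \<open>Turns the pairing of \<open>x * a i\<close> with \<open>b j\<close> into the pairing of
  \<open>x\<close> with \<open>a i * b j\<close>, so that membership in the dual codes
  applies.\<close>

lemma scalar_product_mult_left:
  fixes x y z :: "'a::comm_semiring_1 ^ 'n"
  shows "scalar_product (x * y) z = scalar_product x (y * z)"
  by (simp add: scalar_product_def mult.assoc)

text \<open>The unit vectors indexed by \<open>S\<close> already span \<open>V\<close>.\<close>

lemma dim_supported_le:
  fixes V :: "('a::field ^ 'n) set"
  assumes "\<And>v i. v \<in> V \<Longrightarrow> i \<notin> S \<Longrightarrow> v $ i = 0"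
  shows "vec.dim V \<le> card S"
proof -
  have "v \<in> vec.span ((\<lambda>i. axis i 1) ` S)" if "v \<in> V" for v
  proof -
    have "v = (\<Sum>i\<in>S. v $ i *s axis i 1)"
      using assms[OF that] by (auto simp: vec_eq_iff axis_def if_distrib cong: if_cong)
    also have "\<dots> \<in> vec.span ((\<lambda>i. axis i 1) ` S)"
      by (intro vec.span_sum vec.span_scale vec.span_base imageI)
    finally show ?thesis .
  qed
  then have "vec.dim V \<le> card ((\<lambda>i. axis i (1::'a)) ` S)"
    by (intro vec.dim_le_card) auto
  also have "\<dots> \<le> card S"
    by (simp add: card_image_le)
  finally show ?thesis .
qed

text \<open>Pairing with \<open>u (Suc w)\<close> is a linear functional that kills all earlier
  \<open>v i\<close> but not \<open>v (Suc w)\<close>, so each new vector leaves the span of the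
  earlier ones. Pairings with i > j are left arbitrary.\<close>

lemma dim_triangular_pairing:
  fixes v u :: "nat \<Rightarrow> 'a::field ^ 'n"
  assumes "\<And>i j. 1 \<le> i \<Longrightarrow> i < j \<Longrightarrow> j \<le> w \<Longrightarrow> scalar_product (v i) (u j) = 0"
    and "\<And>j. 1 \<le> j \<Longrightarrow> j \<le> w \<Longrightarrow> scalar_product (v j) (u j) \<noteq> 0"
  shows "vec.dim (v ` {1..w}) = w"
  using assms
proof (induction w)
  case 0
  show ?case by simp
next
  case (Suc w)
  have "vec.span (v ` {1..w}) \<subseteq> {x. scalar_product x (u (Suc w)) = 0}"
    using Suc.prems(1) by (intro vec.span_minimal subspace_orthogonal) auto
  then have "v (Suc w) \<notin> vec.span (v ` {1..w})"
    using Suc.prems(2)[of "Suc w"] by auto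
  moreover have "vec.dim (v ` {1..w}) = w"
    by (rule Suc.IH) (use Suc.prems in auto)
  ultimately show ?case
    by (simp add: atLeastAtMostSuc_conv vec.dim_insert)
qed

lemma span_insert_eq_of_quotient_dim_1:
  fixes C C1 :: "('a::field ^ 'n) set"
  assumes "vec.subspace C" "vec.subspace C1" "C1 \<subseteq> C" "quotient_dim C C1 = 1"
    and "x \<in> C" "x \<notin> C1"
  shows "vec.span (insert x C1) = C"
proof -
  have "x \<notin> vec.span C1"
    using assms by (metis vec.span_eq_iff)
  \<comment> \<open>A truncated difference equal to 1 is a true one, so \<open>C\<close> has
    dimension one more than \<open>C1\<close>, just as \<open>insert x C1\<close> does.\<close>
  then have "vec.dim (insert x C1) = vec.dim C"
    using assms(4) by (simp add: vec.dim_insert quotient_dim_def)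
  then have "vec.span (insert x C1) = vec.span C"
    using assms by (intro vec.dim_eq_span) auto
  then show ?thesis
    using assms(1) by (metis vec.span_eq_iff)
qed

theorem theorem1p2:
  fixes C C1 D D1 :: "('a::{field,finite} ^ 'n) set"
    and a b :: "nat \<Rightarrow> 'a ^ 'n"
    and w :: nat
  assumes "vec.subspace C" and "vec.subspace C1"
    and "C1 \<subset> C"
    and "quotient_dim C C1 = 1"
    and "D = dual_code C" and "D1 = dual_code C1"
    and "\<And>i j. i \<in> {1..w} \<Longrightarrow> j \<in> {1..w} \<Longrightarrow> i + j \<le> w \<Longrightarrow> a i * b j \<in> D"
    and "\<And>i j. i \<in> {1..w} \<Longrightarrow> j \<in> {1..w} \<Longrightarrow> i + j = w + 1 \<Longrightarrow> a i * b j \<in> D1 - D"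
  shows "coset_distance C C1 \<ge> w"
proof -
  have "w \<le> hamming_dist x 0" if x: "x \<in> C" "x \<notin> C1" for x
  proof -
    have span: "vec.span (insert x C1) = C"
      using assms x by (intro span_insert_eq_of_quotient_dim_1) auto
    have nonzero: "scalar_product x y \<noteq> 0" if y: "y \<in> D1 - D" for y
    proof
      assume "scalar_product x y = 0"
      \<comment> \<open>Since \<open>y\<close> is orthogonal to \<open>C1\<close> by membership in
        \<open>D1\<close>, orthogonality to \<open>x\<close> as well would put it into
        \<open>D\<close>.\<close>
      then have "vec.span (insert x C1) \<subseteq> {z. scalar_product z y = 0}"
        using y assms(6) by (intro vec.span_minimal subspace_orthogonal) (auto simp: dual_code_def)
      then show False
        using y assms(5) span by (auto simp: dual_code_def)
    qed
    \<comment> \<open>Reversing the order of the \<open>b j\<close> makes the index sum i + (w + 1 -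
      j): at most w exactly when i < j, and equal to w + 1 on the diagonal.\<close>
    have "scalar_product (x * a i) (b (w + 1 - j)) = 0" if "1 \<le> i" "i < j" "j \<le> w" for i j
    proof -
      have "a i * b (w + 1 - j) \<in> D"
        by (rule assms(7)) (use that in auto)
      then show ?thesis
        using x(1) assms(5) by (simp add: scalar_product_mult_left dual_code_def)
    qed
    moreover have "scalar_product (x * a j) (b (w + 1 - j)) \<noteq> 0" if "1 \<le> j" "j \<le> w" for j
      unfolding scalar_product_mult_left by (intro nonzero assms(8)) (use that in auto)
    ultimately have "vec.dim ((\<lambda>i. x * a i) ` {1..w}) = w"
      by (rule dim_triangular_pairing)
    moreover have "vec.dim ((\<lambda>i. x * a i) ` {1..w}) \<le> card {i. x $ i \<noteq> 0}"
      by (rule dim_supported_le) auto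
    ultimately show ?thesis
      by (simp add: hamming_dist_def)
  qed
  \<comment> \<open>The bound passes to \<open>Min\<close> only for a nonempty finite set;
    strictness of the inclusion supplies an element.\<close>
  moreover have "{hamming_dist x 0 | x. x \<in> C \<and> x \<notin> C1} \<noteq> {}"
    using assms(3) by auto
  moreover have "finite {hamming_dist x 0 | x. x \<in> C \<and> x \<notin> C1}"
    by simp
  ultimately show ?thesis
    unfolding coset_distance_def by (subst Min_ge_iff) auto
qed

end
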